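(* Let $P$ and $Q$ be probability distributions on a measurable space $(\mathcal{X},\mathcal{F})$ with densities $p,q$ with respect to a dominating $\sigma$-finite measure $\mu$, and let $D_\infty(P\|Q)=\lim_{\alpha\uparrow\infty}D_\alpha(P\|Q)$. Then $$D_\infty(P\|Q)=\ln\sup_{A\in\mathcal{F}}\frac{P(A)}{Q(A)}=\ln\Big(\operatorname*{ess\,sup}_P\frac{p}{q}\Big),$$ with the conventions that $0/0=0$ and $x/0=\infty$ if $x>0$.
   Context: Rényi divergence: for $\alpha\in(1,\infty)$, $D_\alpha(P\|Q)=\frac{1}{\alpha-1}\ln\int p^\alpha q^{1-\alpha}\,d\mu\in[0,\infty]$, where one reads $p^\alpha q^{1-\alpha}$ as $p^\alpha/q^{\alpha-1}$ with the conventions $0/0=0$ and $x/0=\infty$ for $x>0$ (the value does not depend on $\mu$). For a random variable $X$, the essential supremum with respect to $P$ is $\operatorname{ess\,sup}_P X=\sup\{c\mid P(X>c)>0\}$. *)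

theory Defs
  imports "HOL-Probability.Probability"
begin

definition ennreal_ln :: "ennreal \<Rightarrow> ereal" where
  "ennreal_ln x =
     (if x = 0 then - \<infinity> else if x = \<infinity> then \<infinity> else ereal (ln (enn2real x)))"

(* The Renyi divergence of order a > 1 of the measures with nonnegative densities p and q
   with respect to M. Division in ennreal satisfies 0 / 0 = 0 and x / 0 = \<infinity> for x > 0,
   which is the required reading of p^a * q^(1-a) as p^a / q^(a-1). *)
definition renyi_divergence ::
    "real \<Rightarrow> 'a measure \<Rightarrow> ('a \<Rightarrow> real) \<Rightarrow> ('a \<Rightarrow> real) \<Rightarrow> ereal" where
  "renyi_divergence a M p q =
     ereal (1 / (a - 1)) *
       ennreal_ln (\<integral>\<^sup>+ x. ennreal (p x powr a) / ennreal (q x powr (a - 1)) \<partial>M)"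

(* Lim is a definite description and says nothing about existence of the limit. *)
definition renyi_divergence_infinity ::
    "'a measure \<Rightarrow> ('a \<Rightarrow> real) \<Rightarrow> ('a \<Rightarrow> real) \<Rightarrow> ereal" where
  "renyi_divergence_infinity M p q = Lim at_top (\<lambda>a. renyi_divergence a M p q)"

lemma ennreal_division_conventions:
  fixes x :: ennreal
  shows "0 / 0 = (0 :: ennreal)" and "0 < x \<Longrightarrow> x / 0 = \<infinity>"
  by (auto simp: ennreal_divide_zero)

lemma esssup_eq_Sup:
  fixes f :: "'a \<Rightarrow> 'b :: {second_countable_topology, dense_linorder, linorder_topology, complete_linorder}"
  assumes f: "f \<in> borel_measurable M"
  shows "esssup M f = Sup {c. 0 < emeasure M {x \<in> space M. c < f x}}"
proof (rule antisym)
  let ?S = "Sup {c. 0 < emeasure M {x \<in> space M. c < f x}}"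
  show "esssup M f \<le> ?S"
  proof (rule dense_ge)
    fix z assume "?S < z"
    then have "z \<notin> {c. 0 < emeasure M {x \<in> space M. c < f x}}"
      by (meson Sup_upper leD)
    then have "emeasure M {x \<in> space M. z < f x} = 0"
      by (simp add: zero_less_iff_neq_zero)
    then show "esssup M f \<le> z"
      unfolding esssup_eq[OF f] by (intro Inf_lower) simp
  qed
next
  show "Sup {c. 0 < emeasure M {x \<in> space M. c < f x}} \<le> esssup M f"
  proof (rule Sup_least)
    fix c assume c: "c \<in> {c. 0 < emeasure M {x \<in> space M. c < f x}}"
    show "c \<le> esssup M f"
    proof (rule ccontr)
      assume "\<not> c \<le> esssup M f"
      then have "{x \<in> space M. c < f x} \<subseteq> {x \<in> space M. esssup M f < f x}" by auto
      then have "emeasure M {x \<in> space M. c < f x} \<le> emeasure M {x \<in> space M. esssup M f < f x}"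
        using f by (intro emeasure_mono) auto
      with c show False by (simp add: esssup_zero_measure)
    qed
  qed
qed

end

theory Submission
  imports Defs "HOL-Real_Asymp.Real_Asymp"
begin

text \<open>
  Put \<open>r = p / q\<close> and \<open>L = esssup\<^sub>P r\<close>. The integral in \<open>D\<^sub>a\<close> is the \<open>P\<close>-integral of \<open>r\<^bsup>a-1\<^esup>\<close>,
  hence at most \<open>L\<^bsup>a-1\<^esup>\<close>; and for every \<open>0 < c < L\<close> it is at least \<open>c\<^bsup>a-1\<^esup> P(r > c)\<close> with
  \<open>P(r > c) > 0\<close>. Taking logarithms and dividing by \<open>a - 1\<close> squeezes \<open>D\<^sub>a\<close> to \<open>ln L\<close>. Likewise
  \<open>P(A) \<le> L Q(A)\<close> for all \<open>A\<close>, while \<open>A = {r > c}\<close> gives a ratio of at least \<open>c\<close>.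
\<close>

section \<open>Extended logarithm and pointwise bounds on the integrand\<close>

lemma ennreal_ln_ennreal: "0 < c \<Longrightarrow> ennreal_ln (ennreal c) = ereal (ln c)"
  by (simp add: ennreal_ln_def)

lemma ennreal_ln_mono:
  assumes "x \<le> y" shows "ennreal_ln x \<le> ennreal_ln y"
proof (cases x; cases y)
  fix a b assume ab: "0 \<le> a" "x = ennreal a" "0 \<le> b" "y = ennreal b"
  with assms show ?thesis
    by (cases "a = 0"; cases "b = 0") (auto simp: ennreal_ln_def)
qed (use assms in \<open>auto simp: ennreal_ln_def top_unique\<close>)

text \<open>Take \<open>c = exp z\<close> for a real \<open>z\<close> strictly between
  \<open>y\<close> and \<open>ennreal_ln L\<close>. This treats finite and infinite \<open>L\<close>
  alike, so lower bounds are only needed for real levels \<open>c > 0\<close>.\<close>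

lemma less_ennreal_lnE:
  assumes "y < ennreal_ln L"
  obtains c where "0 < c" "y < ereal (ln c)" "ennreal c < L"
proof -
  obtain z where z: "y < ereal z" "ereal z < ennreal_ln L"
    using ereal_dense2[OF assms] by auto
  have "ennreal (exp z) < L"
  proof (rule ccontr)
    assume "\<not> ennreal (exp z) < L"
    then have "ennreal_ln L \<le> ennreal_ln (ennreal (exp z))"
      by (intro ennreal_ln_mono) simp
    with z(2) show False by (simp add: ennreal_ln_ennreal)
  qed
  with z(1) that[of "exp z"] show ?thesis by simp
qed

text \<open>Cross-multiplication survives \<open>v = 0\<close>: by the conventions for division by
  zero, both sides then say \<open>0 < u\<close>. The strict inequality matters, since the version
  with \<le> fails at \<open>u = v = 0\<close> for \<open>c > 0\<close>.\<close>

lemma ennreal_less_divide_iff: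
  assumes "0 \<le> u" "0 \<le> v" "0 \<le> c"
  shows "ennreal c < ennreal u / ennreal v \<longleftrightarrow> c * v < u"
proof (cases "v = 0")
  case True
  then show ?thesis
    using assms by (cases "u = 0") (auto simp: ennreal_divide_zero)
next
  case False
  then show ?thesis
    using assms by (simp add: divide_ennreal ennreal_less_iff pos_less_divide_eq)
qed

text \<open>For \<open>v > 0\<close> the right side is \<open>(u / v) powr (a - 1) * u\<close>, and
  \<open>u / v > c\<close>. For \<open>v = 0\<close> the hypothesis gives \<open>u > 0\<close>, so
  the right side is infinite.\<close>

lemma renyi_integrand_ge:
  assumes "0 \<le> v" "0 < c" "1 \<le> a" "c * v < u"
  shows "ennreal (c powr (a - 1)) * ennreal u \<le> ennreal (u powr a) / ennreal (v powr (a - 1))"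
proof (cases "v = 0")
  case True
  then show ?thesis using assms by (simp add: ennreal_divide_zero)
next
  case False
  with assms have v: "0 < v" and u: "0 < u"
    by (auto intro: le_less_trans[OF mult_nonneg_nonneg[of c v]])
  have "(c * v) powr (a - 1) \<le> u powr (a - 1)"
    using assms by (intro powr_mono2) auto
  then have "c powr (a - 1) * v powr (a - 1) * u \<le> u powr (a - 1) * u"
    using assms u v by (simp add: powr_mult)
  also have "\<dots> = u powr a" using u by (simp add: powr_mult_base mult.commute)
  finally show ?thesis
    using u v by (simp add: divide_ennreal ennreal_mult[symmetric] pos_le_divide_eq mult_ac)
qed

lemma renyi_integrand_le:
  assumes "0 \<le> u" "0 \<le> v" "0 < c" "1 \<le> a" "u \<le> c * v"
  shows "ennreal (u powr a) / ennreal (v powr (a - 1)) \<le> ennreal (c powr (a - 1)) * ennreal u"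
proof (cases "u = 0")
  case False
  \<comment> \<open>A positive \<open>u\<close> below \<open>c * v\<close> forces
    \<open>v > 0\<close>, so the quotient is an ordinary real one. For \<open>u = 0\<close> the left
    side is 0, even when it reads 0 / 0.\<close>
  with assms have u: "0 < u" and v: "0 < v"
    by (auto simp: less_le)
  have "u powr a = u powr (a - 1) * u" using u by (simp add: powr_mult_base mult.commute)
  also have "\<dots> \<le> (c * v) powr (a - 1) * u"
    using assms by (intro mult_right_mono powr_mono2) auto
  also have "\<dots> = c powr (a - 1) * v powr (a - 1) * u"
    using assms by (simp add: powr_mult)
  finally show ?thesis
    using u v by (simp add: divide_ennreal ennreal_mult[symmetric] pos_divide_le_eq mult_ac)
qed simp

section \<open>Two densities, their ratio and its essential supremum\<close>

locale density_pair =
  fixes \<mu> P Q :: "'a measure" and p q :: "'a \<Rightarrow> real"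
  assumes p_measurable [measurable]: "p \<in> borel_measurable \<mu>"
    and p_nonneg: "\<And>x. x \<in> space \<mu> \<Longrightarrow> 0 \<le> p x"
    and q_measurable [measurable]: "q \<in> borel_measurable \<mu>"
    and q_nonneg: "\<And>x. x \<in> space \<mu> \<Longrightarrow> 0 \<le> q x"
    and prob_space_P: "prob_space P" and P_eq: "P = density \<mu> (\<lambda>x. ennreal (p x))"
    and prob_space_Q: "prob_space Q" and Q_eq: "Q = density \<mu> (\<lambda>x. ennreal (q x))"
begin

definition ratio :: "'a \<Rightarrow> ennreal" where "ratio x = ennreal (p x) / ennreal (q x)"

lemma ratio_measurable [measurable]: "ratio \<in> borel_measurable \<mu>"
  unfolding ratio_def by measurable

lemma sets_P [measurable_cong]: "sets P = sets \<mu>" and space_P: "space P = space \<mu>"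
  by (simp_all add: P_eq)

lemma emeasure_P_eq: "A \<in> sets \<mu> \<Longrightarrow> emeasure P A = (\<integral>\<^sup>+x. ennreal (p x) * indicator A x \<partial>\<mu>)"
  by (simp add: P_eq emeasure_density)

lemma emeasure_Q_eq: "A \<in> sets \<mu> \<Longrightarrow> emeasure Q A = (\<integral>\<^sup>+x. ennreal (q x) * indicator A x \<partial>\<mu>)"
  by (simp add: Q_eq emeasure_density)

lemma nn_integral_p: "(\<integral>\<^sup>+x. ennreal (p x) \<partial>\<mu>) = 1"
  using emeasure_P_eq[of "space \<mu>"] prob_space.emeasure_space_1[OF prob_space_P]
  by (simp add: space_P cong: nn_integral_cong)

text \<open>A statement that holds \<open>P\<close>-almost everywhere holds \<mu>-almost everywhere
  on \<open>p > 0\<close>. Where \<open>p = 0\<close>, the product form of the bound is automatic,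
  which upgrades it to \<mu>.\<close>

lemma AE_le_if_esssup_le:
  assumes "esssup P ratio \<le> ennreal c" "0 \<le> c"
  shows "AE x in \<mu>. p x \<le> c * q x"
proof -
  have "AE x in P. ratio x \<le> ennreal c"
    using esssup_AE[of ratio P] assms(1) by (auto elim!: eventually_mono)
  then have "AE x in \<mu>. 0 < p x \<longrightarrow> ratio x \<le> ennreal c"
    unfolding P_eq by (subst (asm) AE_density) auto
  then show ?thesis
    using AE_space
  proof eventually_elim
    case (elim x)
    show ?case
    proof (cases "0 < p x")
      case True
      then show ?thesis
        using elim ennreal_less_divide_iff[OF p_nonneg[of x] q_nonneg[of x] assms(2)]
        by (auto simp: ratio_def not_less[symmetric])
    next
      case False
      then show ?thesis
        using mult_nonneg_nonneg[OF assms(2) q_nonneg[of x]] elim by simp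
    qed
  qed
qed

text \<open>Otherwise the preceding bound with \<open>c = 0\<close> makes \<open>p\<close> vanish
  almost everywhere, against total mass 1. This supplies the positive constant required by
  \<open>renyi_integrand_le\<close>.\<close>

lemma esssup_ratio_pos: "0 < esssup P ratio"
proof (rule ccontr)
  assume "\<not> ?thesis"
  then have "AE x in \<mu>. p x \<le> 0"
    using AE_le_if_esssup_le[of 0] by simp
  then have "(\<integral>\<^sup>+x. ennreal (p x) \<partial>\<mu>) = (\<integral>\<^sup>+x. 0 \<partial>\<mu>)"
    by (intro nn_integral_cong_AE) (auto elim!: eventually_mono simp: ennreal_neg)
  then show False by (simp add: nn_integral_p)
qed

text \<open>Some level \<open>d > c\<close> is exceeded with positive probability, and superlevel
  sets grow as the level decreases.\<close>

lemma emeasure_ratio_pos: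
  assumes "c < esssup P ratio"
  shows "0 < emeasure P {x \<in> space \<mu>. c < ratio x}"
proof -
  have "esssup P ratio = Sup {c. 0 < emeasure P {x \<in> space \<mu>. c < ratio x}}"
    using esssup_eq_Sup[of ratio P] by (simp add: space_P)
  with assms obtain d where "0 < emeasure P {x \<in> space \<mu>. d < ratio x}" "c < d"
    by (auto simp: less_Sup_iff)
  then show ?thesis
    by (elim order_less_le_trans) (auto intro!: emeasure_mono)
qed

lemma less_ratio_iff:
  "0 \<le> c \<Longrightarrow> x \<in> space \<mu> \<Longrightarrow> ennreal c < ratio x \<longleftrightarrow> c * q x < p x"
  by (simp add: ratio_def ennreal_less_divide_iff p_nonneg q_nonneg)

section \<open>Essential supremum as a supremum of ratios of probabilities\<close>

lemma SUP_ratio_le_esssup: "(SUP A\<in>sets \<mu>. emeasure P A / emeasure Q A) \<le> esssup P ratio"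
proof (rule SUP_least)
  fix A assume A [measurable]: "A \<in> sets \<mu>"
  show "emeasure P A / emeasure Q A \<le> esssup P ratio"
  proof (cases "esssup P ratio")
    case (real c)
    have "emeasure P A \<le> (\<integral>\<^sup>+x. ennreal c * (ennreal (q x) * indicator A x) \<partial>\<mu>)"
      unfolding emeasure_P_eq[OF A]
    proof (rule nn_integral_mono_AE)
      show "AE x in \<mu>. ennreal (p x) * indicator A x \<le> ennreal c * (ennreal (q x) * indicator A x)"
        using AE_le_if_esssup_le[of c] AE_space real
        by (auto elim!: eventually_elim2 simp: ennreal_mult[symmetric] q_nonneg ennreal_leI
              split: split_indicator)
    qed
    also have "\<dots> = ennreal c * emeasure Q A"
      by (simp add: nn_integral_cmult emeasure_Q_eq)
    finally have le: "emeasure P A \<le> ennreal c * emeasure Q A" .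
    show ?thesis
    proof (cases "emeasure Q A = 0")
      \<comment> \<open>Here \<open>le\<close> forces P(A) = 0, so the quotient is 0 / 0 =
        0.\<close>
      case True
      with le show ?thesis by simp
    next
      case False
      with le show ?thesis
        using finite_measure.emeasure_finite[OF prob_space.finite_measure[OF prob_space_Q], of A]
        by (simp add: real divide_le_posI_ennreal zero_less_iff_neq_zero mult.commute)
    qed
  qed simp
qed

text \<open>Every \<open>d\<close> strictly below the essential supremum is finite and is attained
  as a lower bound by the superlevel set of \<open>ratio\<close> at height \<open>d\<close>, on
  which \<open>d * q < p\<close>.\<close>

lemma esssup_le_SUP_ratio: "esssup P ratio \<le> (SUP A\<in>sets \<mu>. emeasure P A / emeasure Q A)"
proof (rule dense_le)
  fix d assume d: "d < esssup P ratio"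
  then obtain c where c: "0 \<le> c" "d = ennreal c"
    by (cases d) auto
  define A where "A = {x \<in> space \<mu>. d < ratio x}"
  have A [measurable]: "A \<in> sets \<mu>" unfolding A_def by measurable
  have "d * emeasure Q A = (\<integral>\<^sup>+x. ennreal c * (ennreal (q x) * indicator A x) \<partial>\<mu>)"
    by (simp add: nn_integral_cmult emeasure_Q_eq c)
  also have "\<dots> \<le> emeasure P A"
    unfolding emeasure_P_eq[OF A]
    by (intro nn_integral_mono)
       (use c in \<open>auto simp: A_def less_ratio_iff ennreal_mult[symmetric] q_nonneg
                         split: split_indicator intro!: ennreal_leI\<close>)
  finally have "d * emeasure Q A \<le> emeasure P A" .
  moreover have "0 < emeasure P A"
    unfolding A_def by (rule emeasure_ratio_pos[OF d])
  moreover have "emeasure Q A \<noteq> \<infinity>"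
    using finite_measure.emeasure_finite[OF prob_space.finite_measure[OF prob_space_Q], of A] by simp
  \<comment> \<open>If Q(A) = 0, positivity of P(A) makes the quotient infinite rather than 0 / 0;
    otherwise divide by the finite nonzero Q(A).\<close>
  ultimately have "d \<le> emeasure P A / emeasure Q A"
    by (cases "emeasure Q A = 0")
       (auto simp: divide_less_ennreal less_top not_less[symmetric])
  also have "\<dots> \<le> (SUP A\<in>sets \<mu>. emeasure P A / emeasure Q A)"
    by (rule SUP_upper) simp
  finally show "d \<le> \<dots>" .
qed

section \<open>Bounds on the divergence of finite order and the limit\<close>

lemma renyi_divergence_le:
  assumes "1 < a"
  shows "renyi_divergence a \<mu> p q \<le> ennreal_ln (esssup P ratio)"
proof (cases "esssup P ratio")
  case (real c)
  with esssup_ratio_pos have c: "0 < c" by auto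
  have "(\<integral>\<^sup>+x. ennreal (p x powr a) / ennreal (q x powr (a - 1)) \<partial>\<mu>)
      \<le> (\<integral>\<^sup>+x. ennreal (c powr (a - 1)) * ennreal (p x) \<partial>\<mu>)"
  proof (rule nn_integral_mono_AE)
    show "AE x in \<mu>. ennreal (p x powr a) / ennreal (q x powr (a - 1))
        \<le> ennreal (c powr (a - 1)) * ennreal (p x)"
      using AE_le_if_esssup_le[of c] AE_space real c assms
      by (auto elim!: eventually_elim2 intro!: renyi_integrand_le p_nonneg q_nonneg)
  qed
  also have "\<dots> = ennreal (c powr (a - 1))"
    by (simp add: nn_integral_cmult nn_integral_p)
  finally have "ennreal_ln (\<integral>\<^sup>+x. ennreal (p x powr a) / ennreal (q x powr (a - 1)) \<partial>\<mu>)
      \<le> ennreal_ln (ennreal (c powr (a - 1)))"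
    by (rule ennreal_ln_mono)
  also have "\<dots> = ereal ((a - 1) * ln c)"
    using c by (simp add: ennreal_ln_ennreal ln_powr)
  finally have "renyi_divergence a \<mu> p q \<le> ereal (1 / (a - 1)) * ereal ((a - 1) * ln c)"
    unfolding renyi_divergence_def using assms by (intro ereal_mult_left_mono) auto
  then show ?thesis
    using assms c by (simp add: real ennreal_ln_ennreal)
next
  case top
  then show ?thesis by (simp add: ennreal_ln_def)
qed

text \<open>Restricting the integral to the superlevel set at height \<open>c\<close> costs only the
  factor P(A). After taking logarithms this is an error of order 1 / (a - 1), because the set does
  not depend on \<open>a\<close>.\<close>

lemma renyi_divergence_ge:
  assumes "1 < a" "0 < c" "ennreal c < esssup P ratio"
  shows "ereal (ln c + ln (measure P {x \<in> space \<mu>. ennreal c < ratio x}) / (a - 1))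
    \<le> renyi_divergence a \<mu> p q"
proof -
  define A where "A = {x \<in> space \<mu>. ennreal c < ratio x}"
  interpret P: prob_space P by (rule prob_space_P)
  have A [measurable]: "A \<in> sets \<mu>" unfolding A_def by measurable
  \<comment> \<open>Positivity lets the logarithm of the product split into a finite sum.\<close>
  have pos: "0 < measure P A"
    using emeasure_ratio_pos[OF assms(3)] by (simp add: A_def P.emeasure_eq_measure)
  have "ennreal (c powr (a - 1) * measure P A)
      = (\<integral>\<^sup>+x. ennreal (c powr (a - 1)) * (ennreal (p x) * indicator A x) \<partial>\<mu>)"
    by (simp add: nn_integral_cmult emeasure_P_eq[symmetric] P.emeasure_eq_measure ennreal_mult)
  also have "\<dots> \<le> (\<integral>\<^sup>+x. ennreal (p x powr a) / ennreal (q x powr (a - 1)) \<partial>\<mu>)"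
    by (intro nn_integral_mono)
       (use assms in \<open>auto simp: A_def less_ratio_iff split: split_indicator
                         intro!: renyi_integrand_ge q_nonneg\<close>)
  finally have "ennreal_ln (ennreal (c powr (a - 1) * measure P A))
      \<le> ennreal_ln (\<integral>\<^sup>+x. ennreal (p x powr a) / ennreal (q x powr (a - 1)) \<partial>\<mu>)"
    by (rule ennreal_ln_mono)
  moreover have "ennreal_ln (ennreal (c powr (a - 1) * measure P A))
      = ereal ((a - 1) * ln c + ln (measure P A))"
    using assms pos by (subst ennreal_ln_ennreal) (auto simp: ln_mult ln_powr)
  ultimately have "ereal (1 / (a - 1)) * ereal ((a - 1) * ln c + ln (measure P A))
      \<le> renyi_divergence a \<mu> p q"
    unfolding renyi_divergence_def using assms by (intro ereal_mult_left_mono) auto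
  then show ?thesis
    using assms by (simp add: A_def add_divide_distrib)
qed

text \<open>The upper bound is uniform in \<open>a\<close>. For the lower one, \<open>c\<close> is
  fixed first with \<open>y < ln c\<close>, and only then does \<open>a\<close> grow until the error
  term is small enough.\<close>

lemma tendsto_renyi_divergence:
  "((\<lambda>a. renyi_divergence a \<mu> p q) \<longlongrightarrow> ennreal_ln (esssup P ratio)) at_top"
proof (rule order_tendstoI)
  fix y assume "y < ennreal_ln (esssup P ratio)"
  then obtain c where c: "0 < c" "y < ereal (ln c)" "ennreal c < esssup P ratio"
    by (rule less_ennreal_lnE)
  let ?f = "\<lambda>a. ln c + ln (measure P {x \<in> space \<mu>. ennreal c < ratio x}) / (a - 1)"
  have "((\<lambda>a. k + l / (a - 1)) \<longlongrightarrow> k) at_top" for k l :: real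
    by real_asymp
  from this[of "ln c"] have "(?f \<longlongrightarrow> ln c) at_top" .
  then have "((\<lambda>a. ereal (?f a)) \<longlongrightarrow> ereal (ln c)) at_top" by simp
  then have "eventually (\<lambda>a. y < ereal (?f a)) at_top"
    using c(2) by (rule order_tendstoD)
  then show "eventually (\<lambda>a. y < renyi_divergence a \<mu> p q) at_top"
    using eventually_gt_at_top[of 1]
    by eventually_elim (rule less_le_trans[OF _ renyi_divergence_ge[OF _ c(1,3)]])
next
  fix y assume y: "ennreal_ln (esssup P ratio) < y"
  show "eventually (\<lambda>a. renyi_divergence a \<mu> p q < y) at_top"
    using eventually_gt_at_top[of 1]
    by eventually_elim (rule le_less_trans[OF renyi_divergence_le y])
qed

end

theorem theorem6:
  fixes \<mu> P Q :: "'a measure" and p q :: "'a \<Rightarrow> real"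
  assumes "sigma_finite_measure \<mu>"
    and "p \<in> borel_measurable \<mu>" and "\<And>x. x \<in> space \<mu> \<Longrightarrow> 0 \<le> p x"
    and "q \<in> borel_measurable \<mu>" and "\<And>x. x \<in> space \<mu> \<Longrightarrow> 0 \<le> q x"
    and "prob_space P" and "P = density \<mu> (\<lambda>x. ennreal (p x))"
    and "prob_space Q" and "Q = density \<mu> (\<lambda>x. ennreal (q x))"
  shows "((\<lambda>\<alpha>. renyi_divergence \<alpha> \<mu> p q) \<longlongrightarrow> renyi_divergence_infinity \<mu> p q) at_top
    \<and> renyi_divergence_infinity \<mu> p q = ennreal_ln (SUP A\<in>sets \<mu>. emeasure P A / emeasure Q A)
    \<and> ennreal_ln (SUP A\<in>sets \<mu>. emeasure P A / emeasure Q A)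
        = ennreal_ln (esssup P (\<lambda>x. ennreal (p x) / ennreal (q x)))"
proof -
  interpret density_pair \<mu> P Q p q
    by (rule density_pair.intro) (fact assms)+
  have SUP: "(SUP A\<in>sets \<mu>. emeasure P A / emeasure Q A) = esssup P ratio"
    by (intro antisym SUP_ratio_le_esssup esssup_le_SUP_ratio)
  \<comment> \<open>Convergence is already established, so uniqueness of limits identifies the value
    of \<open>Lim\<close>.\<close>
  have "renyi_divergence_infinity \<mu> p q = ennreal_ln (esssup P ratio)"
    unfolding renyi_divergence_infinity_def
    by (rule tendsto_Lim[OF _ tendsto_renyi_divergence]) simp
  moreover have "ratio = (\<lambda>x. ennreal (p x) / ennreal (q x))"
    by (rule ext) (rule ratio_def)
  ultimately show ?thesis
    using SUP tendsto_renyi_divergence by simp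
qed

end
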